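(* Let $\mu\in\mathbb{R}$, $\sigma>0$, $X\sim\mathrm{LN}(\mu,\sigma^2)$ and $k>0$. Then the (analytically continued) Laplace transform $\phi$ of $X$ has the integral expression $$\phi(z)=\frac{1}{2\pi i}\int_{k-i\infty}^{k+i\infty}\Gamma(s)\,e^{-(\mu+\ln z)s+\frac{\sigma^2}{2}s^2}\,ds,\qquad z\in\mathbb{C}\setminus(-\infty,0].$$
   Context: $X\sim\mathrm{LN}(\mu,\sigma^2)$ (lognormal, $\mu\in\mathbb{R}$, $\sigma>0$) means that $X$ is a positive random variable with density $f(x)=\frac{1}{\sqrt{2\pi}\,\sigma x}\exp\left[-\frac{(\ln x-\mu)^2}{2\sigma^2}\right]$, $x>0$. Its Laplace transform is $\phi(z)=\mathbb{E}[e^{-zX}]$ for $\operatorname{Re}(z)\ge 0$, and $\phi$ also denotes the (unique) analytic continuation of this function from $\{\operatorname{Re}(z)>0\}$ to $\mathbb{C}\setminus(-\infty,0]$. Explicitly, for $z\in\mathbb{C}\setminus(-\infty,0]$, the continuation is $\phi(z)=(2\pi\sigma^2)^{-1/2}e^{-(\mu+\ln z)^2/(2\sigma^2)}\int_0^\infty \frac1x\exp\left[-x-\frac{(\ln x)^2}{2\sigma^2}+\frac{(\mu+\ln z)\ln x}{\sigma^2}\right]dx$. $\ln$ denotes the principal branch of the complex logarithm, and $\Gamma$ is the gamma function. The contour of integration is the vertical line $\operatorname{Re}(s)=k$, traversed upward. *)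

theory Defs
  imports "HOL-Probability.Probability" "HOL-Complex_Analysis.Complex_Analysis"
begin

definition lognormal_density :: "real \<Rightarrow> real \<Rightarrow> real \<Rightarrow> real" where
  "lognormal_density \<mu> \<sigma> x =
     (if x > 0 then 1 / (sqrt (2 * pi) * \<sigma> * x) * exp (- ((ln x - \<mu>)\<^sup>2 / (2 * \<sigma>\<^sup>2))) else 0)"

definition laplace_transform :: "'a measure \<Rightarrow> ('a \<Rightarrow> real) \<Rightarrow> complex \<Rightarrow> complex" where
  "laplace_transform M X z = (\<integral>\<omega>. exp (- z * of_real (X \<omega>)) \<partial>M)"

(* Only the values on V are meaningful; by continuation_eqI they are determined by f and U
   if U is open and nonempty, V is open and connected, and a holomorphic extension exists. *)
definition continuation ::
  "complex set \<Rightarrow> complex set \<Rightarrow> (complex \<Rightarrow> complex) \<Rightarrow> complex \<Rightarrow> complex" where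
  "continuation U V f = (SOME g. g holomorphic_on V \<and> (\<forall>z\<in>U. g z = f z))"

lemma continuation_eqI:
  assumes "open U" "U \<noteq> {}" "open V" "connected V" "U \<subseteq> V"
    and g: "g holomorphic_on V" "\<And>z. z \<in> U \<Longrightarrow> g z = f z"
    and "z \<in> V"
  shows "continuation U V f z = g z"
proof -
  let ?h = "continuation U V f"
  have h: "?h holomorphic_on V \<and> (\<forall>z\<in>U. ?h z = f z)"
    unfolding continuation_def by (rule someI[of _ g]) (use g in auto)
  show ?thesis
    by (rule analytic_continuation_open[where s = U and s' = V]) (use assms h in auto)
qed

definition laplace_continuation :: "'a measure \<Rightarrow> ('a \<Rightarrow> real) \<Rightarrow> complex \<Rightarrow> complex" where
  "laplace_continuation M X =
     continuation {z. Re z > 0} (- \<real>\<^sub>\<le>\<^sub>0) (laplace_transform M X)"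

(* The integral of f along the line Re s = k, traversed upward: with s = k + i t, ds = i dt.
   As a Lebesgue integral it has the value 0 unless f is absolutely integrable on the line. *)
definition vline_integrable :: "real \<Rightarrow> (complex \<Rightarrow> complex) \<Rightarrow> bool" where
  "vline_integrable k f \<longleftrightarrow> integrable lborel (\<lambda>t. f (Complex k t) * \<i>)"

definition vline_integral :: "real \<Rightarrow> (complex \<Rightarrow> complex) \<Rightarrow> complex" where
  "vline_integral k f = (\<integral>t. f (Complex k t) * \<i> \<partial>lborel)"

end

theory Submission
  imports Defs
begin

text \<open>On the line the Gamma factor is bounded, while the exponential decays like a Gaussian in
  the imaginary part, locally uniformly in the coefficient of the linear term. Hence the contour
  integral is holomorphic on the slit plane, and by the identity theorem only positive real
  arguments remain to be checked. There one inserts Euler's integral for the Gamma function and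
  swaps the integrals: the inner Gaussian contour integral produces the lognormal density up to
  scaling, and rescaling the outer variable by the argument gives the Laplace transform.\<close>

section \<open>Holomorphy of integrals that depend on a complex parameter\<close>

text \<open>Differentiation under the integral sign. A majorant of \<open>f\<close> alone suffices,
  because Cauchy's inequality turns it into a majorant of the derivatives and hence of the
  difference quotients; dominated convergence then applies.\<close>

lemma holomorphic_on_lebesgue_integral:
  fixes f :: "complex \<Rightarrow> 'a \<Rightarrow> complex"
  assumes "open S"
    and hol: "\<And>x. (\<lambda>z. f z x) holomorphic_on S"
    and meas: "\<And>z. f z \<in> borel_measurable M"
    and dom: "\<And>z0. z0 \<in> S \<Longrightarrow>
      \<exists>r>0. \<exists>g. integrable M g \<and> (\<forall>z\<in>ball z0 r. \<forall>x. norm (f z x) \<le> g x)"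
  shows "(\<lambda>z. \<integral>x. f z x \<partial>M) holomorphic_on S"
  unfolding holomorphic_on_open[OF \<open>open S\<close>]
proof (intro ballI)
  fix z0 assume z0: "z0 \<in> S"
  obtain r1 g where r1: "r1 > 0" and g: "integrable M g"
    and bd1: "\<And>z x. z \<in> ball z0 r1 \<Longrightarrow> norm (f z x) \<le> g x"
    using dom[OF z0] by blast
  obtain r2 where r2: "r2 > 0" "ball z0 r2 \<subseteq> S"
    using \<open>open S\<close> z0 open_contains_ball by blast
  \<comment> \<open>A third of the common radius leaves room around each point of
    \<open>ball z0 r\<close> for a closed disc of radius \<open>r\<close> on which both holomorphy
    and the majorant are available.\<close>
  define r where "r = min r1 r2 / 3"
  have r: "r > 0" using r1 r2 by (simp add: r_def)
  have big: "z \<in> ball z0 r1 \<inter> S" if "dist z0 z < 3 * r" for z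
    using that r2 by (auto simp: r_def)
  have hol': "(\<lambda>z. f z x) holomorphic_on ball z0 (3 * r)" for x
    by (rule holomorphic_on_subset[OF hol]) (use big in auto)
  have der: "((\<lambda>z. f z x) has_field_derivative deriv (\<lambda>z. f z x) z) (at z)"
    if "z \<in> ball z0 (3 * r)" for z x
    by (rule holomorphic_derivI[OF hol' open_ball that])
  have der_bd: "norm (deriv (\<lambda>z. f z x) z) \<le> g x / r" if "z \<in> ball z0 r" for z x
  proof -
    have sub: "cball z r \<subseteq> ball z0 (3 * r)"
    proof
      fix y assume "y \<in> cball z r"
      then show "y \<in> ball z0 (3 * r)"
        using that r dist_triangle[of z0 y z] by simp
    qed
    have "norm ((deriv ^^ 1) (\<lambda>z. f z x) z) \<le> fact 1 * g x / r ^ 1"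
    proof (rule Cauchy_inequality)
      show "(\<lambda>z. f z x) holomorphic_on ball z r"
        by (rule holomorphic_on_subset[OF hol']) (use sub ball_subset_cball in blast)
      show "continuous_on (cball z r) (\<lambda>z. f z x)"
        by (rule holomorphic_on_imp_continuous_on, rule holomorphic_on_subset[OF hol' sub])
      show "norm (f y x) \<le> g x" if "norm (z - y) = r" for y
      proof -
        have "y \<in> cball z r" using that by (simp add: dist_norm)
        then have "dist z0 y < 3 * r" using sub by auto
        then show ?thesis using big bd1 by blast
      qed
    qed (rule r)
    then show ?thesis by simp
  qed
  have lip: "norm (f z x - f z0 x) \<le> g x / r * norm (z - z0)" if "z \<in> ball z0 r" for z x
  proof (rule field_differentiable_bound[where S = "ball z0 r" and f = "\<lambda>z. f z x"])
    show "((\<lambda>z. f z x) has_field_derivative deriv (\<lambda>z. f z x) w) (at w within ball z0 r)"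
      if "w \<in> ball z0 r" for w
      by (rule has_field_derivative_at_within[OF der]) (use that r in auto)
  qed (use that r der_bd in auto)
  have int: "integrable M (f z)" if "z \<in> ball z0 r" for z
  proof (rule Bochner_Integration.integrable_bound[OF g meas])
    have "z \<in> ball z0 r1" using that big[of z] r by auto
    then show "AE x in M. norm (f z x) \<le> norm (g x)"
      by (intro AE_I2) (simp add: order_trans[OF bd1 abs_ge_self])
  qed
  let ?D = "\<lambda>x. deriv (\<lambda>z. f z x) z0"
  let ?I = "\<lambda>z. \<integral>x. f z x \<partial>M"
  \<comment> \<open>Dominated convergence speaks of sequences, so the limit is tested along
    sequences. Working within the ball keeps all their members where \<open>lip\<close> and
    \<open>int\<close> hold.\<close>
  have "((\<lambda>z. (?I z - ?I z0) / (z - z0)) \<longlongrightarrow> (\<integral>x. ?D x \<partial>M)) (at z0 within ball z0 r)"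
    unfolding tendsto_at_iff_sequentially comp_def
  proof (intro allI impI)
    fix Z assume Z: "\<forall>i. Z i \<in> ball z0 r - {z0}" and lim: "Z \<longlonglongrightarrow> z0"
    let ?q = "\<lambda>i x. (f (Z i) x - f z0 x) / (Z i - z0)"
    have q_lim: "(\<lambda>i. ?q i x) \<longlonglongrightarrow> ?D x" for x
    proof -
      have "((\<lambda>z. (f z x - f z0 x) / (z - z0)) \<longlongrightarrow> ?D x) (at z0)"
        using der[of z0 x] r by (simp add: has_field_derivative_iff)
      moreover have "filterlim Z (at z0) sequentially"
        using lim Z by (auto simp: filterlim_at)
      ultimately show ?thesis by (rule filterlim_compose)
    qed
    note meas[measurable]
    have "(\<lambda>i. \<integral>x. ?q i x \<partial>M) \<longlonglongrightarrow> (\<integral>x. ?D x \<partial>M)"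
    proof (rule integral_dominated_convergence[where w = "\<lambda>x. g x / r"])
      show q_meas: "?q i \<in> borel_measurable M" for i by measurable
      \<comment> \<open>Measurability of the derivative is inherited from the difference quotients,
        of which it is the pointwise limit.\<close>
      show "?D \<in> borel_measurable M"
        by (rule borel_measurable_LIMSEQ_metric[OF q_meas q_lim])
      show "integrable M (\<lambda>x. g x / r)" using g by simp
      show "AE x in M. norm (?q i x) \<le> g x / r" for i
        using lip[of "Z i"] Z by (auto simp: norm_divide divide_le_eq)
      show "AE x in M. (\<lambda>i. ?q i x) \<longlonglongrightarrow> ?D x" using q_lim by simp
    qed
    moreover have "(\<integral>x. ?q i x \<partial>M) = (?I (Z i) - ?I z0) / (Z i - z0)" for i
      using int[of "Z i"] int[of z0] Z r by simp
    ultimately show "(\<lambda>i. (?I (Z i) - ?I z0) / (Z i - z0)) \<longlonglongrightarrow> (\<integral>x. ?D x \<partial>M)"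
      by (simp only:)
  qed
  then have "(?I has_field_derivative (\<integral>x. ?D x \<partial>M)) (at z0)"
    using r by (simp add: has_field_derivative_iff at_within_open[OF centre_in_ball[THEN iffD2]])
  then show "\<exists>d. (?I has_field_derivative d) (at z0)" by blast
qed

section \<open>Euler's integral for the Gamma function\<close>

text \<open>Euler's integrand x^(s-1) e^(-x), extended by zero. Writing the power through
  \<open>exp\<close> and \<open>ln\<close> makes it jointly measurable in \<open>s\<close> and
  \<open>x\<close> and lets it merge with other exponentials.\<close>

definition Gamma_kernel :: "complex \<Rightarrow> real \<Rightarrow> complex" where
  "Gamma_kernel s x = (if x > 0 then exp ((s - 1) * of_real (ln x) - of_real x) else 0)"

lemma Gamma_kernel_measurable [measurable]: "Gamma_kernel s \<in> borel_measurable borel"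
  unfolding Gamma_kernel_def by measurable

lemma norm_Gamma_kernel: "norm (Gamma_kernel s x) = norm (Gamma_kernel (of_real (Re s)) x)"
  by (simp add: Gamma_kernel_def)

text \<open>Euler's formula is available as a gauge integral. Absolute integrability turns it into a
  Lebesgue integral over \<open>lebesgue\<close>, and Borel measurability of the kernel allows the
  passage to \<open>lborel\<close>.\<close>

lemma has_bochner_integral_Gamma_kernel:
  assumes "Re s > 0"
  shows "has_bochner_integral lborel (Gamma_kernel s) (Gamma s)"
proof -
  let ?f = "\<lambda>t. complex_of_real t powr (s - 1) / of_real (exp t)"
  have eq: "indicat_real {0<..} x *\<^sub>R ?f x = Gamma_kernel s x" for x
    by (auto simp: Gamma_kernel_def powr_def exp_diff exp_of_real Ln_of_real)
  have abs: "?f absolutely_integrable_on {0<..}"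
    by (rule absolutely_integrable_Gamma_integral'[OF assms])
  then have "integrable lebesgue (Gamma_kernel s)"
    by (simp add: set_integrable_def eq)
  then have int: "integrable lborel (Gamma_kernel s)"
    by (simp add: integrable_completion)
  have "Gamma s = (LINT x:{0<..}|lebesgue. ?f x)"
    using Gamma_integral_complex'[OF assms] set_lebesgue_integral_eq_integral(2)[OF abs]
    by (simp add: integral_unique)
  also have "\<dots> = (\<integral>x. Gamma_kernel s x \<partial>lborel)"
    by (simp add: set_lebesgue_integral_def eq integral_completion)
  finally show ?thesis using int by (simp add: has_bochner_integral_iff)
qed

text \<open>The modulus of the kernel depends on \<open>s\<close> only through its real part, so
  this bound is constant along a vertical line.\<close>

lemma norm_Gamma_le:
  assumes "Re s > 0"
  shows "norm (Gamma s) \<le> (\<integral>x. norm (Gamma_kernel (of_real (Re s)) x) \<partial>lborel)"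
proof -
  have "Gamma s = (\<integral>x. Gamma_kernel s x \<partial>lborel)"
    using has_bochner_integral_Gamma_kernel[OF assms] by (simp add: has_bochner_integral_iff)
  then show ?thesis
    using integral_norm_bound[of lborel "Gamma_kernel s"] by (simp add: norm_Gamma_kernel[of s])
qed

section \<open>Gaussian decay and holomorphy of the contour integral\<close>

lemma vline_continuous [continuous_intros]: "continuous_on A (\<lambda>t. Complex k t)"
  by (simp add: Complex_eq) (intro continuous_intros)

lemma vline_measurable [measurable]: "(\<lambda>t. Complex k t) \<in> borel_measurable borel"
  by (intro borel_measurable_continuous_onI continuous_intros)

lemma Gamma_vline_measurable [measurable]:
  assumes "k > 0"
  shows "(\<lambda>t. Gamma (Complex k t)) \<in> borel_measurable borel"
proof (rule borel_measurable_continuous_onI)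
  have "Complex k t \<notin> \<int>\<^sub>\<le>\<^sub>0" for t
    using assms by (auto elim!: nonpos_Ints_cases simp: complex_eq_iff)
  then show "continuous_on UNIV (\<lambda>t. Gamma (Complex k t))"
    by (intro continuous_on_compose2[OF continuous_on_Gamma[of "range (Complex k)"]])
      (auto intro: continuous_intros)
qed

text \<open>The decay comes from s^2, whose real part on the line is k^2 - t^2; the linear term
  grows at most linearly in \<open>t\<close>.\<close>

lemma Re_vline_exponent:
  "Re (- c * Complex k t + of_real (\<sigma>\<^sup>2 / 2) * (Complex k t)\<^sup>2) =
   - Re c * k + Im c * t + \<sigma>\<^sup>2 / 2 * (k\<^sup>2 - t\<^sup>2)"
  by (simp add: power2_eq_square algebra_simps)

lemma integrable_gaussian:
  assumes "a > 0"
  shows "integrable lborel (\<lambda>t::real. exp (- (a * t\<^sup>2)))"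
proof -
  \<comment> \<open>Variance 1 / (2 a) gives the exponent -a t^2, and the factor cancels the
    normalisation.\<close>
  have "integrable lborel (\<lambda>t. sqrt (pi / a) * normal_density 0 (1 / sqrt (2 * a)) t)"
    using assms by (intro integrable_mult_right integrable_normal_density) simp
  also have "(\<lambda>t. sqrt (pi / a) * normal_density 0 (1 / sqrt (2 * a)) t) = (\<lambda>t. exp (- (a * t\<^sup>2)))"
    using assms by (auto simp: normal_density_def field_simps real_sqrt_divide real_sqrt_mult)
  finally show ?thesis .
qed

text \<open>The bound sees \<open>c\<close> only through \<open>B\<close>, so one integrable
  function of \<open>t\<close> serves a whole disc of parameters. Half of the available decay is
  spent on the linear term \<open>Im c * t\<close>.\<close>

lemma vline_integrand_bound:
  assumes "\<sigma> > 0" "k > 0" "norm c \<le> B"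
  shows "norm (Gamma (Complex k t) * exp (- c * Complex k t + of_real (\<sigma>\<^sup>2 / 2) * (Complex k t)\<^sup>2))
    \<le> (\<integral>x. norm (Gamma_kernel (of_real k) x) \<partial>lborel) *
       (exp (B * k + B\<^sup>2 / \<sigma>\<^sup>2 + \<sigma>\<^sup>2 * k\<^sup>2 / 2) * exp (- (\<sigma>\<^sup>2 / 4 * t\<^sup>2)))"
proof -
  have "B \<ge> 0" using assms(3) norm_ge_zero order_trans by blast
  have 1: "- Re c * k \<le> B * k"
    using abs_Re_le_cmod[of c] assms by (intro mult_right_mono) auto
  have "Im c * t \<le> \<bar>Im c\<bar> * \<bar>t\<bar>" by (metis abs_ge_self abs_mult)
  also have "\<dots> \<le> B * \<bar>t\<bar>"
    using abs_Im_le_cmod[of c] assms by (intro mult_right_mono) auto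
  \<comment> \<open>Young's inequality, weighted so that exactly half of the decay
    \<open>\<sigma>\<^sup>2 / 2 * t\<^sup>2\<close> is consumed.\<close>
  also have "\<dots> \<le> B\<^sup>2 / \<sigma>\<^sup>2 + \<sigma>\<^sup>2 / 4 * t\<^sup>2"
  proof -
    have "0 \<le> (B / \<sigma> - \<sigma> / 2 * \<bar>t\<bar>)\<^sup>2" by simp
    also have "\<dots> = B\<^sup>2 / \<sigma>\<^sup>2 + \<sigma>\<^sup>2 / 4 * t\<^sup>2 - B * \<bar>t\<bar>"
      using assms(1) by (simp add: power2_diff power_divide power_mult_distrib)
    finally show ?thesis by simp
  qed
  finally have 2: "Im c * t \<le> B\<^sup>2 / \<sigma>\<^sup>2 + \<sigma>\<^sup>2 / 4 * t\<^sup>2" .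
  have "norm (exp (- c * Complex k t + of_real (\<sigma>\<^sup>2 / 2) * (Complex k t)\<^sup>2))
      = exp (- Re c * k + Im c * t + \<sigma>\<^sup>2 / 2 * (k\<^sup>2 - t\<^sup>2))"
    by (simp only: norm_exp_eq_Re Re_vline_exponent)
  also have "\<dots> \<le> exp ((B * k + B\<^sup>2 / \<sigma>\<^sup>2 + \<sigma>\<^sup>2 * k\<^sup>2 / 2) + - (\<sigma>\<^sup>2 / 4 * t\<^sup>2))"
    using 1 2 unfolding exp_le_cancel_iff by (simp add: algebra_simps)
  finally have "norm (exp (- c * Complex k t + of_real (\<sigma>\<^sup>2 / 2) * (Complex k t)\<^sup>2))
    \<le> exp (B * k + B\<^sup>2 / \<sigma>\<^sup>2 + \<sigma>\<^sup>2 * k\<^sup>2 / 2) * exp (- (\<sigma>\<^sup>2 / 4 * t\<^sup>2))"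
    by (simp only: exp_add)
  moreover have "norm (Gamma (Complex k t)) \<le> (\<integral>x. norm (Gamma_kernel (of_real k) x) \<partial>lborel)"
    using norm_Gamma_le[of "Complex k t"] assms by simp
  ultimately show ?thesis
    unfolding norm_mult by (intro mult_mono) auto
qed

lemma integrable_vline_integrand:
  assumes "\<sigma> > 0" "k > 0"
  shows "integrable lborel (\<lambda>t. Gamma (Complex k t) *
    exp (- c * Complex k t + of_real (\<sigma>\<^sup>2 / 2) * (Complex k t)\<^sup>2))"
proof (rule Bochner_Integration.integrable_bound)
  note Gamma_vline_measurable[OF assms(2), measurable]
  show "(\<lambda>t. Gamma (Complex k t) * exp (- c * Complex k t + of_real (\<sigma>\<^sup>2 / 2) * (Complex k t)\<^sup>2))
    \<in> borel_measurable lborel" by measurable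
  show "integrable lborel (\<lambda>t. (\<integral>x. norm (Gamma_kernel (of_real k) x) \<partial>lborel) *
     (exp (norm c * k + (norm c)\<^sup>2 / \<sigma>\<^sup>2 + \<sigma>\<^sup>2 * k\<^sup>2 / 2) * exp (- (\<sigma>\<^sup>2 / 4 * t\<^sup>2))))"
    using assms by (intro integrable_mult_right integrable_gaussian) simp
qed (intro AE_I2 order_trans[OF vline_integrand_bound[OF assms order_refl]], simp)

text \<open>The coefficient \<open>c\<close> of the linear term is the variable here, which gives an
  entire function. The logarithm, and with it the slit, enters only afterwards by
  composition.\<close>

lemma holomorphic_vline_integral:
  assumes "\<sigma> > 0" "k > 0"
  shows "(\<lambda>c. \<integral>t. Gamma (Complex k t) *
    exp (- c * Complex k t + of_real (\<sigma>\<^sup>2 / 2) * (Complex k t)\<^sup>2) \<partial>lborel) holomorphic_on UNIV"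
proof (rule holomorphic_on_lebesgue_integral)
  note Gamma_vline_measurable[OF assms(2), measurable]
  show "(\<lambda>t. Gamma (Complex k t) * exp (- c * Complex k t + of_real (\<sigma>\<^sup>2 / 2) * (Complex k t)\<^sup>2))
    \<in> borel_measurable lborel" for c by measurable
  fix c0 :: complex
  let ?g = "\<lambda>B t. (\<integral>x. norm (Gamma_kernel (of_real k) x) \<partial>lborel) *
     (exp (B * k + B\<^sup>2 / \<sigma>\<^sup>2 + \<sigma>\<^sup>2 * k\<^sup>2 / 2) * exp (- (\<sigma>\<^sup>2 / 4 * t\<^sup>2)))"
  have "integrable lborel (?g (norm c0 + 1))"
    using assms by (intro integrable_mult_right integrable_gaussian) simp
  moreover have "norm c \<le> norm c0 + 1" if "c \<in> ball c0 1" for c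
    using that norm_triangle_ineq2[of c c0] by (simp add: dist_norm norm_minus_commute)
  ultimately show "\<exists>r>0. \<exists>g. integrable lborel g \<and> (\<forall>c\<in>ball c0 r. \<forall>t. norm (Gamma (Complex k t) *
      exp (- c * Complex k t + of_real (\<sigma>\<^sup>2 / 2) * (Complex k t)\<^sup>2)) \<le> g t)"
    using vline_integrand_bound[OF assms]
    by (intro exI[of _ 1] conjI exI[of _ "?g (norm c0 + 1)"]) auto
qed (auto intro!: holomorphic_intros)

corollary holomorphic_vline_integral_ln:
  assumes "\<sigma> > 0" "k > 0"
  shows "(\<lambda>z. \<integral>t. Gamma (Complex k t) * exp (- (a + ln z) * Complex k t +
    of_real (\<sigma>\<^sup>2 / 2) * (Complex k t)\<^sup>2) \<partial>lborel) holomorphic_on - \<real>\<^sub>\<le>\<^sub>0"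
proof -
  have "(\<lambda>c. \<integral>t. Gamma (Complex k t) * exp (- c * Complex k t + of_real (\<sigma>\<^sup>2 / 2) * (Complex k t)\<^sup>2)
      \<partial>lborel) \<circ> (\<lambda>z. a + ln z) holomorphic_on - \<real>\<^sub>\<le>\<^sub>0"
    by (rule holomorphic_on_compose_gen[OF _ holomorphic_vline_integral[OF assms]])
      (auto intro!: holomorphic_intros)
  then show ?thesis by (simp only: comp_def)
qed

section \<open>Evaluation of the contour integral at positive real arguments\<close>

text \<open>After t = u / \<sigma> the integrand is a constant times the standard normal density
  times e^(ibu), so the integral is the characteristic function of the standard normal law at
  \<open>b\<close>.\<close>

lemma gaussian_vline_integral:
  assumes "\<sigma> > 0"
  shows "(\<integral>t. exp (of_real a * Complex k t + of_real (\<sigma>\<^sup>2 / 2) * (Complex k t)\<^sup>2) \<partial>lborel) =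
    of_real (sqrt (2 * pi) / \<sigma> * exp (- (a\<^sup>2 / (2 * \<sigma>\<^sup>2))))" (is "(\<integral>t. ?f t \<partial>lborel) = _")
proof -
  \<comment> \<open>\<open>b\<close> is the frequency of the oscillating factor; \<open>C\<close>
    collects the factors free of \<open>u\<close>, with \<open>sqrt (2 * pi)\<close> undoing the
    normalisation of the density.\<close>
  define b where "b = (a + \<sigma>\<^sup>2 * k) / \<sigma>"
  define C where "C = exp (a * k + \<sigma>\<^sup>2 * k\<^sup>2 / 2) * sqrt (2 * pi)"
  have f: "?f (0 + 1 / \<sigma> * u) = of_real C * (std_normal_density u *\<^sub>R iexp (b * u))" for u
  proof -
    have "of_real C * (std_normal_density u *\<^sub>R iexp (b * u)) =
        of_real (exp (a * k + \<sigma>\<^sup>2 * k\<^sup>2 / 2)) * of_real (exp (- u\<^sup>2 / 2)) * iexp (b * u)"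
      by (simp add: C_def std_normal_density_def scaleR_conv_of_real)
    also have "\<dots> = exp (of_real (a * k + \<sigma>\<^sup>2 * k\<^sup>2 / 2) + of_real (- u\<^sup>2 / 2) + \<i> * of_real (b * u))"
      by (simp only: exp_add exp_of_real)
    also have "of_real (a * k + \<sigma>\<^sup>2 * k\<^sup>2 / 2) + of_real (- u\<^sup>2 / 2) + \<i> * of_real (b * u) =
        of_real a * Complex k (0 + 1 / \<sigma> * u) + of_real (\<sigma>\<^sup>2 / 2) * (Complex k (0 + 1 / \<sigma> * u))\<^sup>2"
      using assms by (simp add: complex_eq_iff b_def power2_eq_square field_simps)
    finally show ?thesis by simp
  qed
  have "(\<integral>t. ?f t \<partial>lborel) = (1 / \<sigma>) *\<^sub>R (\<integral>u. ?f (0 + 1 / \<sigma> * u) \<partial>lborel)"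
    using assms lborel_integral_real_affine[of "1 / \<sigma>" ?f 0] by simp
  also have "\<dots> = (1 / \<sigma>) *\<^sub>R (of_real C * (\<integral>u. std_normal_density u *\<^sub>R iexp (b * u) \<partial>lborel))"
    by (simp only: f integral_mult_right_zero)
  also have "(\<integral>u. std_normal_density u *\<^sub>R iexp (b * u) \<partial>lborel) = char std_normal_distribution b"
    unfolding char_def by (subst integral_density) auto
  also have "\<dots> = of_real (exp (- b\<^sup>2 / 2))"
    by (simp add: char_std_normal_distribution)
  also have "(1 / \<sigma>) *\<^sub>R (of_real C * of_real (exp (- b\<^sup>2 / 2))) =
      complex_of_real (sqrt (2 * pi) / \<sigma> * (exp (a * k + \<sigma>\<^sup>2 * k\<^sup>2 / 2) * exp (- b\<^sup>2 / 2)))"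
    by (simp add: C_def scaleR_conv_of_real)
  \<comment> \<open>All terms in \<open>k\<close> cancel, as they must, since the integrand is
    entire and the contour may be shifted.\<close>
  also have "exp (a * k + \<sigma>\<^sup>2 * k\<^sup>2 / 2) * exp (- b\<^sup>2 / 2) = exp (- (a\<^sup>2 / (2 * \<sigma>\<^sup>2)))"
    unfolding exp_add[symmetric] exp_inj_iff b_def
    using assms by (simp add: power2_eq_square field_simps)
  finally show ?thesis .
qed

lemma lognormal_density_nonneg: "\<sigma> > 0 \<Longrightarrow> lognormal_density \<mu> \<sigma> x \<ge> 0"
  by (simp add: lognormal_density_def)

lemma lognormal_density_measurable [measurable]: "lognormal_density \<mu> \<sigma> \<in> borel_measurable borel"
  unfolding lognormal_density_def by measurable

text \<open>Write c = \<mu> + ln z, which is real. Inside Euler's integral, x^(s-1) e^(-cs) equals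
  e^((ln x - c) s) / x, so after Fubini the integral over the line is Gaussian. Substituting x = z y
  turns ln x - c into ln y - \<mu> and e^(-x) into e^(-zy).\<close>

lemma vline_integral_of_pos_real:
  assumes "\<sigma> > 0" "k > 0" "z > 0"
  shows "(\<integral>t. Gamma (Complex k t) *
      exp (- of_real (\<mu> + ln z) * Complex k t + of_real (\<sigma>\<^sup>2 / 2) * (Complex k t)\<^sup>2) \<partial>lborel) =
    of_real (2 * pi) * (\<integral>x. lognormal_density \<mu> \<sigma> x *\<^sub>R exp (- of_real z * of_real x) \<partial>lborel)"
proof -
  define c where "c = \<mu> + ln z"
  define E where "E t = exp (- of_real c * Complex k t + of_real (\<sigma>\<^sup>2 / 2) * (Complex k t)\<^sup>2)" for t
  define h where "h t x = Gamma_kernel (Complex k t) x * E t" for t x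
  have E_meas [measurable]: "E \<in> borel_measurable borel" unfolding E_def by measurable
  have h_meas [measurable]: "(\<lambda>(t, x). h t x) \<in> borel_measurable (lborel \<Otimes>\<^sub>M lborel)"
    unfolding h_def Gamma_kernel_def by measurable
  have G: "integrable lborel (Gamma_kernel (Complex k t))"
      "(\<integral>x. Gamma_kernel (Complex k t) x \<partial>lborel) = Gamma (Complex k t)" for t
    using has_bochner_integral_Gamma_kernel[of "Complex k t"] assms
    by (auto simp: has_bochner_integral_iff)
  \<comment> \<open>An exact value: as \<open>c\<close> is real, the exponent has no real part
    linear in \<open>t\<close>.\<close>
  have norm_E: "norm (E t) = exp (- c * k + \<sigma>\<^sup>2 * k\<^sup>2 / 2) * exp (- (\<sigma>\<^sup>2 / 2 * t\<^sup>2))" for t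
    unfolding E_def norm_exp_eq_Re Re_vline_exponent exp_add[symmetric]
    by (simp add: algebra_simps)
  have E_int: "integrable lborel (\<lambda>t. norm (E t))"
    unfolding norm_E using assms by (intro integrable_mult_right integrable_gaussian) simp
  \<comment> \<open>The modulus of \<open>h t x\<close> is a function of \<open>x\<close> times a
    function of \<open>t\<close>, because the modulus of the kernel is constant along the
    line.\<close>
  have h_int: "integrable (lborel \<Otimes>\<^sub>M lborel) (\<lambda>(t, x). h t x)"
  proof (rule lborel_pair.Fubini_integrable[OF h_meas])
    have "(\<integral>x. norm (h t x) \<partial>lborel) =
        (\<integral>x. norm (Gamma_kernel (of_real k) x) \<partial>lborel) * norm (E t)" for t
      by (simp add: h_def norm_mult norm_Gamma_kernel[of "Complex k t"])
    then show "integrable lborel (\<lambda>t. \<integral>x. norm (case (t, x) of (t, x) \<Rightarrow> h t x) \<partial>lborel)"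
      using E_int by simp
    show "AE t in lborel. integrable lborel (\<lambda>x. case (t, x) of (t, x) \<Rightarrow> h t x)"
      using G by (simp add: h_def)
  qed
  have inner: "(\<integral>t. h t x \<partial>lborel) = (if x > 0 then of_real (exp (- x) / x *
      (sqrt (2 * pi) / \<sigma> * exp (- ((ln x - c)\<^sup>2 / (2 * \<sigma>\<^sup>2))))) else 0)" (is "_ = ?r x") for x
  proof (cases "x > 0")
    case True
    have "h t x = of_real (exp (- x) / x) *
        exp (of_real (ln x - c) * Complex k t + of_real (\<sigma>\<^sup>2 / 2) * (Complex k t)\<^sup>2)" for t
    proof -
      have "h t x = exp (of_real (- x - ln x) +
        (of_real (ln x - c) * Complex k t + of_real (\<sigma>\<^sup>2 / 2) * (Complex k t)\<^sup>2))"
        using True by (simp add: h_def E_def Gamma_kernel_def exp_add[symmetric] algebra_simps)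
      also have "exp (complex_of_real (- x - ln x)) = of_real (exp (- x) / x)"
        unfolding exp_of_real using True by (simp add: exp_diff)
      then have "exp (of_real (- x - ln x) +
        (of_real (ln x - c) * Complex k t + of_real (\<sigma>\<^sup>2 / 2) * (Complex k t)\<^sup>2)) =
        of_real (exp (- x) / x) *
        exp (of_real (ln x - c) * Complex k t + of_real (\<sigma>\<^sup>2 / 2) * (Complex k t)\<^sup>2)"
        by (simp only: exp_add)
      finally show ?thesis .
    qed
    then have "(\<integral>t. h t x \<partial>lborel) = of_real (exp (- x) / x) *
      (\<integral>t. exp (of_real (ln x - c) * Complex k t + of_real (\<sigma>\<^sup>2 / 2) * (Complex k t)\<^sup>2) \<partial>lborel)"
      by (simp only: integral_mult_right_zero)
    then show ?thesis
      using True by (simp only: gaussian_vline_integral[OF assms(1)] of_real_mult if_True)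
  qed (simp add: h_def Gamma_kernel_def)
  have "(\<integral>t. Gamma (Complex k t) * E t \<partial>lborel) = (\<integral>t. (\<integral>x. h t x \<partial>lborel) \<partial>lborel)"
    by (simp add: h_def G)
  also have "\<dots> = (\<integral>x. (\<integral>t. h t x \<partial>lborel) \<partial>lborel)"
    by (rule lborel_pair.Fubini_integral[OF h_int, symmetric])
  also have "\<dots> = (\<integral>x. ?r x \<partial>lborel)"
    by (simp only: inner)
  \<comment> \<open>The substitution x = z y; since \<open>z\<close> is positive, it preserves the
    half-line on which the integrand lives.\<close>
  also have "\<dots> = z *\<^sub>R (\<integral>y. ?r (0 + z * y) \<partial>lborel)"
    using assms lborel_integral_real_affine[of z ?r 0] by simp
  also have "\<dots> = (\<integral>y. z *\<^sub>R ?r (0 + z * y) \<partial>lborel)"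
    by (simp only: integral_scaleR_right)
  also have "(\<lambda>y. z *\<^sub>R ?r (0 + z * y)) =
      (\<lambda>y. of_real (2 * pi) * (lognormal_density \<mu> \<sigma> y *\<^sub>R exp (- of_real z * of_real y)))"
  proof
    fix y
    show "z *\<^sub>R ?r (0 + z * y) =
      of_real (2 * pi) * (lognormal_density \<mu> \<sigma> y *\<^sub>R exp (- of_real z * of_real y))"
    proof (cases "y > 0")
      case True
      have "z * (exp (- (z * y)) / (z * y) * (sqrt (2 * pi) / \<sigma> * e)) =
          2 * pi * (1 / (sqrt (2 * pi) * \<sigma> * y) * e * exp (- (z * y)))" for e
      proof -
        \<comment> \<open>With q = sqrt (2 pi), the factor q of the Gaussian integral equals 2 pi /
          q: this is where the constant 2 pi and the normalisation of the density come from.\<close>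
        have "z * (d / (z * y) * (q / \<sigma> * e)) = p * (1 / (q * \<sigma> * y) * e * d)"
          if "q > 0" "p = q * q" for q p d :: real
          unfolding that(2) using that(1) True assms by (simp add: field_simps)
        from this[of "sqrt (2 * pi)" "2 * pi"] show ?thesis by simp
      qed
      moreover have "ln (z * y) - c = ln y - \<mu>"
        using True assms by (simp add: c_def ln_mult)
      moreover have "exp (- complex_of_real z * of_real y) = of_real (exp (- (z * y)))"
        by (simp flip: exp_of_real)
      ultimately show ?thesis
        using True assms(3)
        by (simp only: lognormal_density_def scaleR_conv_of_real of_real_mult[symmetric]
            add_0_left zero_less_mult_iff if_True simp_thms)
    qed (use assms in \<open>simp add: lognormal_density_def zero_less_mult_iff\<close>)
  qed
  finally show ?thesis
    by (simp only: E_def c_def integral_mult_right_zero)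
qed

section \<open>The Laplace transform of a lognormal variable in the right half-plane\<close>

context
  fixes M :: "'a measure" and X :: "'a \<Rightarrow> real" and \<mu> \<sigma> :: real
  assumes M: "prob_space M"
    and \<sigma>: "\<sigma> > 0"
    and X: "distributed M lborel X (\<lambda>x. ennreal (lognormal_density \<mu> \<sigma> x))"
begin

text \<open>No integral is computed: integrability of the density amounts to that of the constant 1
  over the probability space.\<close>

lemma integrable_lognormal_density: "integrable lborel (lognormal_density \<mu> \<sigma>)"
proof -
  interpret prob_space M by (rule M)
  show ?thesis
    using distributed_integrable[OF X, of "\<lambda>_. 1"] lognormal_density_nonneg[OF \<sigma>] by simp
qed

text \<open>This needs no restriction on \<open>z\<close>: if the integrand is not integrable, both
  sides take the default value 0.\<close>

lemma laplace_transform_lognormal: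
  "laplace_transform M X z =
   (\<integral>x. lognormal_density \<mu> \<sigma> x *\<^sub>R exp (- z * of_real x) \<partial>lborel)"
proof -
  have [measurable]: "X \<in> borel_measurable M"
    using distributed_measurable[OF X] by simp
  have "laplace_transform M X z = (\<integral>x. exp (- z * of_real x) \<partial>distr M lborel X)"
    unfolding laplace_transform_def by (subst integral_distr) auto
  also have "distr M lborel X = density lborel (\<lambda>x. ennreal (lognormal_density \<mu> \<sigma> x))"
    by (rule distributed_distr_eq_density[OF X])
  also have "(\<integral>x. exp (- z * of_real x) \<partial>\<dots>) =
      (\<integral>x. lognormal_density \<mu> \<sigma> x *\<^sub>R exp (- z * of_real x) \<partial>lborel)"
    using lognormal_density_nonneg[OF \<sigma>] by (subst integral_density) auto
  finally show ?thesis .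
qed

lemma holomorphic_laplace_transform_lognormal:
  "laplace_transform M X holomorphic_on {z. Re z > 0}"
  unfolding laplace_transform_lognormal
proof (rule holomorphic_on_lebesgue_integral)
  show "open {z. Re z > 0}" by (rule open_halfspace_Re_gt)
  fix z0 :: complex assume z0: "z0 \<in> {z. Re z > 0}"
  \<comment> \<open>The ball of radius \<open>Re z0\<close> stays in the right half-plane, where
    e^(-zx) has modulus at most 1 for positive \<open>x\<close>; so the density itself is the
    majorant.\<close>
  have "norm (lognormal_density \<mu> \<sigma> x *\<^sub>R exp (- z * of_real x)) \<le> lognormal_density \<mu> \<sigma> x"
    if "z \<in> ball z0 (Re z0)" for z x
  proof (cases "x > 0")
    case True
    have "\<bar>Re (z0 - z)\<bar> \<le> dist z0 z" unfolding dist_norm by (rule abs_Re_le_cmod)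
    then have "Re z \<ge> 0" using that by simp
    then have "norm (exp (- z * of_real x)) \<le> 1" using True by simp
    then show ?thesis
      using lognormal_density_nonneg[OF \<sigma>, of \<mu> x] by (simp add: mult_left_le)
  qed (simp add: lognormal_density_def)
  then show "\<exists>r>0. \<exists>g. integrable lborel g \<and> (\<forall>z\<in>ball z0 r. \<forall>x.
      norm (lognormal_density \<mu> \<sigma> x *\<^sub>R exp (- z * of_real x)) \<le> g x)"
    using z0 integrable_lognormal_density by (intro exI[of _ "Re z0"] exI conjI) auto
next
  show "(\<lambda>x. lognormal_density \<mu> \<sigma> x *\<^sub>R exp (- z * of_real x)) \<in> borel_measurable lborel" for z :: complex
    by measurable
  show "(\<lambda>z. lognormal_density \<mu> \<sigma> x *\<^sub>R exp (- z * of_real x)) holomorphic_on {z. Re z > 0}" for x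
    unfolding scaleR_conv_of_real by (intro holomorphic_intros)
qed

text \<open>Identity theorem: both sides are holomorphic in the half-plane and agree on the positive
  reals, which accumulate at the interior point 1.\<close>

lemma laplace_transform_eq_vline_integral:
  assumes "k > 0" "Re z > 0"
  shows "1 / of_real (2 * pi) * (\<integral>t. Gamma (Complex k t) *
      exp (- (of_real \<mu> + ln z) * Complex k t + of_real (\<sigma>\<^sup>2 / 2) * (Complex k t)\<^sup>2) \<partial>lborel) =
    laplace_transform M X z" (is "?G z = _")
proof -
  let ?U = "complex_of_real ` {0<..}"
  have "?G holomorphic_on {z. Re z > 0}"
    by (intro holomorphic_on_mult holomorphic_on_const
        holomorphic_on_subset[OF holomorphic_vline_integral_ln[OF \<sigma> assms(1)]])
      (auto simp: complex_nonpos_Reals_iff)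
  then have "(\<lambda>z. ?G z - laplace_transform M X z) holomorphic_on {z. Re z > 0}"
    by (intro holomorphic_on_diff holomorphic_laplace_transform_lognormal)
  moreover have "?G z - laplace_transform M X z = 0" if z: "z \<in> ?U" for z
  proof -
    obtain x where x: "z = of_real x" "x > 0" using z by auto
    have "of_real \<mu> + ln z = of_real (\<mu> + ln x)" using x by (simp add: Ln_of_real)
    then show ?thesis
      unfolding \<open>of_real \<mu> + ln z = _\<close> vline_integral_of_pos_real[OF \<sigma> assms(1) x(2)]
        laplace_transform_lognormal by (simp add: x(1))
  qed
  moreover have "1 islimpt ?U"
  proof -
    have "(\<lambda>n. complex_of_real (1 + inverse (real (Suc n)))) \<longlonglongrightarrow> of_real (1 + 0)"
      by (intro tendsto_intros LIMSEQ_inverse_real_of_nat)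
    moreover have "of_real (1 + inverse (real (Suc n))) \<in> ?U - {1}" for n
      by (simp add: add_pos_pos del: of_real_add)
    ultimately show ?thesis
      unfolding islimpt_sequential by (intro exI[of _ "\<lambda>n. of_real (1 + inverse (real (Suc n)))"]) auto
  qed
  ultimately have "?G z - laplace_transform M X z = 0"
    using analytic_continuation[where f = "\<lambda>z. ?G z - laplace_transform M X z" and
        S = "{z. Re z > 0}" and U = ?U and \<xi> = 1 and w = z] assms(2)
      open_halfspace_Re_gt[of 0] convex_connected[OF convex_halfspace_Re_gt[of 0]]
    by fastforce
  then show ?thesis by simp
qed

end

theorem theorem2:
  fixes M :: "'a measure" and X :: "'a \<Rightarrow> real" and \<mu> \<sigma> k :: real and z :: complex
  assumes "prob_space M"
    and "\<sigma> > 0"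
    and "distributed M lborel X (\<lambda>x. ennreal (lognormal_density \<mu> \<sigma> x))"
    and "k > 0"
    and "z \<in> - \<real>\<^sub>\<le>\<^sub>0"
  defines "F \<equiv> (\<lambda>s. Gamma s * exp (- (of_real \<mu> + ln z) * s + of_real (\<sigma>\<^sup>2 / 2) * s\<^sup>2))"
  shows "vline_integrable k F \<and>
         laplace_continuation M X z = 1 / (2 * of_real pi * \<i>) * vline_integral k F"
proof
  show "vline_integrable k F"
    unfolding vline_integrable_def F_def
    by (intro integrable_mult_left integrable_vline_integrand assms)
  \<comment> \<open>The factor of ds = i dt is already cancelled against the one in 1 / (2 pi
    i).\<close>
  define G where "G z = 1 / of_real (2 * pi) * (\<integral>t. Gamma (Complex k t) *
    exp (- (of_real \<mu> + ln z) * Complex k t + of_real (\<sigma>\<^sup>2 / 2) * (Complex k t)\<^sup>2) \<partial>lborel)" for z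
  have G_hol: "G holomorphic_on - \<real>\<^sub>\<le>\<^sub>0"
    unfolding G_def by (intro holomorphic_on_mult holomorphic_on_const holomorphic_vline_integral_ln assms)
  \<comment> \<open>\<open>G\<close> witnesses that a holomorphic extension exists, and uniqueness
    on the connected slit plane identifies it with the chosen one.\<close>
  have "laplace_continuation M X z = G z"
    unfolding laplace_continuation_def
  proof (rule continuation_eqI)
    show "{z. Re z > 0} \<noteq> {}" by (auto intro!: exI[of _ 1])
    show "connected (- \<real>\<^sub>\<le>\<^sub>0 :: complex set)"
    proof -
      \<comment> \<open>The slit is rewritten as the image of a real half-line, whose complement is
        starlike and therefore connected.\<close>
      have "(\<real>\<^sub>\<le>\<^sub>0 :: complex set) = of_real ` {..0}"
        by (auto simp: nonpos_Reals_def)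
      then show ?thesis
        using starlike_imp_connected[OF starlike_slotted_complex_plane_left[of 0]] by simp
    qed
    show "G z = laplace_transform M X z" if "z \<in> {z. Re z > 0}" for z
      unfolding G_def using that laplace_transform_eq_vline_integral[OF assms(1-4)] by simp
  qed (use G_hol assms in \<open>auto simp: open_halfspace_Re_gt complex_nonpos_Reals_iff\<close>)
  also have "\<dots> = 1 / (2 * of_real pi * \<i>) * vline_integral k F"
    by (simp add: G_def vline_integral_def F_def)
  finally show "laplace_continuation M X z = 1 / (2 * of_real pi * \<i>) * vline_integral k F" .
qed

end
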